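(* Let $d \geq 1$. There is no tiling of $\mathbb{Z}^d$ by Cartesian cosets in which no two of the tiles are translates of one another. Equivalently: if $\mathbb{Z}^d$ is the disjoint union of finitely many Cartesian cosets $T_1, \dots, T_n$ with $n \geq 2$, then there exist $i \neq j$ such that $T_j = \mathbf{w} + T_i$ for some $\mathbf{w} \in \mathbb{Z}^d$.
   Context: A Cartesian coset in $\mathbb{Z}^d$ is a set of the form $\mathbf{v} + L$ where $\mathbf{v} \in \mathbb{Z}^d$ and $L = a_1\mathbb{Z} \times \cdots \times a_d\mathbb{Z}$ for positive integers $a_1, \dots, a_d$ (i.e., a Cartesian product of $d$ arithmetic progressions with positive common differences). A tiling of a set $S$ is a nontrivial (at least two members) finite family of pairwise disjoint sets whose union is $S$; its members are called tiles. *)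

theory Defs
  imports "HOL-Analysis.Analysis"
begin

text \<open>\<open>\<int>\<^sup>d\<close> is the type \<open>int ^ 'd\<close> over a finite index type, with \<open>d = CARD('d)\<close>;
  index types are nonempty, so \<open>d \<ge> 1\<close> is built in.\<close>

definition cartesian_lattice :: "int ^ 'd \<Rightarrow> (int ^ 'd) set" where
  "cartesian_lattice a = {x. \<forall>i. x $ i \<in> range (\<lambda>k. a $ i * k)}"

definition cartesian_coset :: "(int ^ 'd) set \<Rightarrow> bool" where
  "cartesian_coset T \<longleftrightarrow>
     (\<exists>v a. (\<forall>i. a $ i > 0) \<and> T = (\<lambda>x. v + x) ` cartesian_lattice a)"

definition tiling :: "'a set set \<Rightarrow> 'a set \<Rightarrow> bool" where
  "tiling \<T> S \<longleftrightarrow> finite \<T> \<and> card \<T> \<ge> 2 \<and> disjoint \<T> \<and> \<Union>\<T> = S"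

definition is_translate :: "'a::plus set \<Rightarrow> 'a set \<Rightarrow> bool" where
  "is_translate T T' \<longleftrightarrow> (\<exists>w. T' = (\<lambda>x. w + x) ` T)"

end

theory Submission
  imports Defs
begin

text \<open>Among the tiles choose one whose vector \<open>a\<close> of common differences has the largest sum, and
  sum the character \<open>x \<mapsto> \<Prod>\<^sub>i exp (2 \<pi> \<i> x\<^sub>i / a\<^sub>i)\<close> over a box whose side is a common multiple of
  all the differences. A tile with differences \<open>b\<close> contributes \<open>0\<close> unless \<open>a\<^sub>i\<close> divides \<open>b\<^sub>i\<close> for
  every \<open>i\<close>, which by the choice of \<open>a\<close> means \<open>b = a\<close>; the chosen tile contributes a nonzero amount.
  The whole box contributes \<open>0\<close> because \<open>a \<noteq> (1, \<dots>, 1)\<close>. So some other tile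
  has the same vector \<open>a\<close>.\<close>

section \<open>Character sums over one arithmetic progression\<close>

lemma cis_eq_1_iff_dvd:
  fixes k a :: int
  assumes "a > 0"
  shows "cis (2 * pi * of_int k / of_int a) = 1 \<longleftrightarrow> a dvd k"
proof
  assume "cis (2 * pi * of_int k / of_int a) = 1"
  then obtain n :: int where "2 * pi * of_int k / of_int a = of_int (2 * n) * pi"
    by (auto simp: cis_conv_exp exp_eq_1)
  then have "of_int k = (of_int (a * n) :: real)"
    using assms by (simp add: field_simps)
  then show "a dvd k"
    by (simp only: of_int_eq_iff dvd_triv_left)
next
  assume "a dvd k"
  then obtain n where "k = a * n" ..
  then show "cis (2 * pi * of_int k / of_int a) = 1"
    using assms cis_multiple_2pi[of "of_int n"] by (simp add: mult.assoc)
qed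

lemma cis_int_periodic:
  fixes x y a :: int
  assumes "a > 0" "a dvd x - y"
  shows "cis (2 * pi * of_int x / of_int a) = cis (2 * pi * of_int y / of_int a)"
proof -
  have "cis (2 * pi * of_int x / of_int a)
      = cis (2 * pi * of_int (x - y) / of_int a) * cis (2 * pi * of_int y / of_int a)"
    by (simp add: cis_mult add_divide_distrib[symmetric] right_diff_distrib)
  then show ?thesis
    using assms by (simp only: cis_eq_1_iff_dvd[THEN iffD2] mult_1)
qed

lemma finite_progression:
  fixes N :: int
  shows "finite {x\<in>{0..<N}. P x}"
  by (rule finite_subset[of _ "{0..<N}"]) auto

text \<open>Shifting by \<open>b\<close> modulo \<open>N\<close> permutes the progression and
  multiplies the sum by \<open>cis (2 * pi * of_int b / of_int a)\<close>. This factor differs from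
  1 because \<open>a\<close> does not divide \<open>b\<close>, so the sum must vanish.\<close>

lemma sum_cis_progression_eq_0:
  fixes a b v N :: int
  assumes "a > 0" "N > 0" "a dvd N" "b dvd N" "\<not> a dvd b"
  shows "(\<Sum>x\<in>{x\<in>{0..<N}. b dvd x - v}. cis (2 * pi * of_int x / of_int a)) = 0"
    (is "sum ?e ?P = 0")
proof -
  have bij: "bij_betw (\<lambda>x. (x + b) mod N) ?P ?P"
  proof (rule bij_betw_byWitness[where f' = "\<lambda>x. (x - b) mod N"])
    \<comment> \<open>Reduction modulo \<open>N\<close> preserves residues modulo \<open>b\<close>
      since \<open>b dvd N\<close>. The cases \<open>c = b\<close> and \<open>c = - b\<close> serve
      the shift and its inverse.\<close>
    have "b dvd (x + c) mod N - v" if "b dvd c" "b dvd x - v" for x c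
    proof -
      have "(x + c) mod N - v = (x - v) + c - N * ((x + c) div N)"
        by (simp add: minus_mult_div_eq_mod[symmetric])
      then show ?thesis
        using that assms(4) by (simp only: dvd_add dvd_diff dvd_mult2)
    qed
    from this[of b] this[of "- b"]
    show "(\<lambda>x. (x + b) mod N) ` ?P \<subseteq> ?P" "(\<lambda>x. (x - b) mod N) ` ?P \<subseteq> ?P"
      using assms by auto
  qed (auto simp: mod_simps)
  have "?e ((x + b) mod N) = cis (2 * pi * of_int b / of_int a) * ?e x" for x
  proof -
    have "(x + b) mod N - (x + b) = - (N * ((x + b) div N))"
      by (simp add: minus_mult_div_eq_mod[symmetric])
    then have "?e ((x + b) mod N) = ?e (x + b)"
      using assms by (intro cis_int_periodic) auto
    then show ?thesis
      by (simp add: cis_mult add_divide_distrib[symmetric] algebra_simps)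
  qed
  then have "sum ?e ?P = cis (2 * pi * of_int b / of_int a) * sum ?e ?P"
    using sum.reindex_bij_betw[OF bij, of ?e] by (simp add: sum_distrib_left)
  then show ?thesis
    using assms by (auto simp: cis_eq_1_iff_dvd)
qed

text \<open>The character has period \<open>a\<close>, hence is constant on the residue class of
  \<open>v\<close>: no cancellation occurs, and only nonemptiness of the index set remains to be
  seen.\<close>

lemma sum_cis_progression_neq_0:
  fixes a v N :: int
  assumes "a > 0" "N > 0" "a dvd N"
  shows "(\<Sum>x\<in>{x\<in>{0..<N}. a dvd x - v}. cis (2 * pi * of_int x / of_int a)) \<noteq> 0"
    (is "sum ?e ?P \<noteq> 0")
proof -
  have "sum ?e ?P = (\<Sum>x\<in>?P. ?e v)"
    by (rule sum.cong) (use assms in \<open>auto intro: cis_int_periodic\<close>)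
  then have "sum ?e ?P = of_nat (card ?P) * ?e v"
    by (simp only: sum_constant)
  moreover have "v mod N \<in> ?P"
    using assms by (simp add: mod_eq_dvd_iff[symmetric] mod_mod_cancel)
  then have "card ?P \<noteq> 0"
    using card_0_eq[OF finite_progression[of N]] by (metis empty_iff)
  ultimately show ?thesis
    by (simp only: mult_eq_0_iff of_nat_eq_0_iff cis_neq_zero simp_thms)
qed

section \<open>From progressions to cosets in a box\<close>

lemma mem_coset_iff:
  "x \<in> (\<lambda>x. v + x) ` cartesian_lattice a \<longleftrightarrow> (\<forall>i. a $ i dvd x $ i - v $ i)"
proof -
  have "x \<in> (\<lambda>x. v + x) ` cartesian_lattice a \<longleftrightarrow> x - v \<in> cartesian_lattice a"
    by (auto simp: image_iff intro!: bexI[of _ "x - v"])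
  then show ?thesis
    by (simp add: cartesian_lattice_def dvd_def image_iff)
qed

definition int_box :: "int \<Rightarrow> (int ^ 'd) set" where
  "int_box N = {x. \<forall>i. x $ i \<in> {0..<N}}"

text \<open>For positive \<open>a\<close> this is a character of the group of integer vectors,
  trivial on \<open>cartesian_lattice a\<close>.\<close>

definition coord_char :: "int ^ 'd \<Rightarrow> int ^ 'd \<Rightarrow> complex" where
  "coord_char a x = (\<Prod>i\<in>UNIV. cis (2 * pi * of_int (x $ i) / of_int (a $ i)))"

text \<open>Membership is a separate condition on each coordinate. The \<open>PiE\<close> form is
  the one needed to exchange product and sum.\<close>

lemma int_box_coset_conv_PiE:
  "int_box N \<inter> (\<lambda>x. v + x) ` cartesian_lattice b
     = vec_lambda ` (\<Pi>\<^sub>E i\<in>UNIV. {x\<in>{0..<N}. b $ i dvd x - v $ i})"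
  (is "?L = vec_lambda ` ?R")
proof -
  have "x \<in> ?L \<longleftrightarrow> vec_nth x \<in> ?R" for x
    by (auto simp: mem_coset_iff int_box_def PiE_iff)
  then have "?L = vec_nth -` ?R"
    by (intro set_eqI) (simp only: vimage_eq)
  moreover have "vec_nth -` A = vec_lambda ` A" for A :: "('a \<Rightarrow> int) set"
  proof (intro set_eqI iffI)
    fix x :: "int ^ 'a"
    assume "x \<in> vec_nth -` A"
    then have "vec_lambda (vec_nth x) \<in> vec_lambda ` A"
      by (intro imageI) simp
    then show "x \<in> vec_lambda ` A"
      by (simp only: vec_nth_inverse)
  qed (auto simp: vec_lambda_inverse)
  ultimately show ?thesis
    by simp
qed

lemma finite_int_box: "finite (int_box N)"
proof -
  \<comment> \<open>With all differences 1 the coset is the whole space.\<close>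
  have "int_box N = int_box N \<inter> (\<lambda>x. 0 + x) ` cartesian_lattice 1"
    using mem_coset_iff[of _ 0 1] by auto
  also have "finite \<dots>"
    unfolding int_box_coset_conv_PiE by (intro finite_imageI finite_PiE finite finite_progression)
  finally show ?thesis .
qed

text \<open>Distributivity: a product of one-coordinate functions, summed over a product set, splits
  into one-dimensional sums.\<close>

lemma sum_coord_char_coset:
  "sum (coord_char a) (int_box N \<inter> (\<lambda>x. v + x) ` cartesian_lattice b)
     = (\<Prod>i\<in>UNIV. \<Sum>x\<in>{x\<in>{0..<N}. b $ i dvd x - v $ i}.
          cis (2 * pi * of_int x / of_int (a $ i)))"
proof -
  have "inj_on vec_lambda A" for A :: "('a \<Rightarrow> int) set"
    by (auto intro!: inj_onI simp: vec_lambda_inject)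
  then show ?thesis
    by (subst prod_sum_PiE[OF finite finite_progression])
      (simp add: int_box_coset_conv_PiE sum.reindex coord_char_def)
qed

lemma sum_coord_char_coset_eq_0:
  assumes "\<And>i. a $ i > 0" "N > 0" "\<And>i. a $ i dvd N" "\<And>i. b $ i dvd N" "\<not> a $ j dvd b $ j"
  shows "sum (coord_char a) (int_box N \<inter> (\<lambda>x. v + x) ` cartesian_lattice b) = 0"
  unfolding sum_coord_char_coset
  using assms by (intro prod_zero bexI[of _ j] sum_cis_progression_eq_0) auto

lemma sum_coord_char_coset_neq_0:
  assumes "\<And>i. a $ i > 0" "N > 0" "\<And>i. a $ i dvd N"
  shows "sum (coord_char a) (int_box N \<inter> (\<lambda>x. v + x) ` cartesian_lattice a) \<noteq> 0"
  unfolding sum_coord_char_coset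
  using sum_cis_progression_neq_0[OF assms] by (subst prod_zero_iff[OF finite]) blast

section \<open>The argument for tilings\<close>

theorem disjoint_cosets_equal_differences:
  fixes T :: "'i \<Rightarrow> (int ^ 'd) set" and v a :: "'i \<Rightarrow> int ^ 'd"
  assumes fin: "finite I" and card: "card I \<ge> 2"
    and pos: "\<And>k i. k \<in> I \<Longrightarrow> a k $ i > 0"
    and T: "\<And>k. k \<in> I \<Longrightarrow> T k = (\<lambda>x. v k + x) ` cartesian_lattice (a k)"
    and disj: "disjoint_family_on T I" and union: "(\<Union>k\<in>I. T k) = UNIV"
  shows "\<exists>k\<in>I. \<exists>l\<in>I. k \<noteq> l \<and> a k = a l"
proof (rule ccontr)
  assume contra: "\<not> ?thesis"
  \<comment> \<open>Raising some coordinates and lowering none strictly increases this sum, so a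
    difference vector maximising it is dominated coordinatewise by no different one.\<close>
  define s where "s k = (\<Sum>i\<in>UNIV. a k $ i)" for k
  have "I \<noteq> {}"
    using card by auto
  then have "Max (s ` I) \<in> s ` I"
    using fin by simp
  then obtain m where m: "m \<in> I" "s m = Max (s ` I)"
    by auto
  then have max: "s k \<le> s m" if "k \<in> I" for k
    using fin that by simp
  define N where "N = (\<Prod>k\<in>I. \<Prod>i\<in>UNIV. a k $ i)"
  have N: "N > 0"
    using pos by (auto simp: N_def intro!: prod_pos)
  have dvd: "a k $ i dvd N" if "k \<in> I" for k i
  proof -
    have "a k $ i dvd (\<Prod>i\<in>UNIV. a k $ i)"
      by (rule dvd_prodI) auto
    also have "\<dots> dvd N"
      unfolding N_def using fin that by (rule dvd_prodI)
    finally show ?thesis .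
  qed
  have zero: "sum (coord_char (a m)) (int_box N \<inter> T k) = 0" if k: "k \<in> I" "k \<noteq> m" for k
  proof -
    \<comment> \<open>Divisibility in every coordinate would give \<open>a m \<le> a k\<close>
      coordinatewise; maximality of \<open>s m\<close> then forces equality, against
      \<open>contra\<close>.\<close>
    have "\<exists>j. \<not> a m $ j dvd a k $ j"
    proof (rule ccontr)
      assume "\<not> ?thesis"
      then have le: "a m $ j \<le> a k $ j" for j
        using pos[OF k(1)] by (auto intro: zdvd_imp_le)
      have "a m $ j = a k $ j" for j
      proof (rule ccontr)
        assume "a m $ j \<noteq> a k $ j"
        with le[of j] have "a m $ j < a k $ j"
          by simp
        then have "s m < s k"
          unfolding s_def using le by (intro sum_strict_mono_ex1) auto
        with max[OF k(1)] show False
          by simp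
      qed
      then have "a m = a k"
        by (simp add: vec_eq_iff)
      with contra k m show False
        by metis
    qed
    then show ?thesis
      using T[OF k(1)] sum_coord_char_coset_eq_0[OF pos[OF m(1)] N dvd[OF m(1)] dvd[OF k(1)]] by auto
  qed
  \<comment> \<open>Otherwise tile \<open>m\<close> fills the space, leaving no room for a second
    tile, which contains its base point \<open>v k\<close>.\<close>
  have "\<exists>j. \<not> a m $ j dvd 1"
  proof (rule ccontr)
    assume "\<not> ?thesis"
    then have "a m $ j dvd x" for j x
      using one_dvd dvd_trans by blast
    then have "T m = UNIV"
      using T[OF m(1)] by (auto simp: mem_coset_iff set_eq_iff)
    moreover have "\<not> I \<subseteq> {m}"
      using card card_mono[of "{m}" I] by auto
    then obtain k where k: "k \<in> I" "k \<noteq> m"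
      by blast
    moreover have "v k \<in> T k"
      using T[OF k(1)] by (simp add: mem_coset_iff)
    ultimately show False
      using disj m(1) by (auto simp: disjoint_family_on_def)
  qed
  then obtain j where "\<not> a m $ j dvd 1" ..
  \<comment> \<open>The whole box is treated as a coset with differences 1, so the vanishing result
    for cosets applies to it as well.\<close>
  then have "sum (coord_char (a m)) (int_box N \<inter> (\<lambda>x. 0 + x) ` cartesian_lattice 1) = 0"
    using N pos[OF m(1)] dvd[OF m(1)] by (intro sum_coord_char_coset_eq_0[where j = j]) auto
  also have "int_box N \<inter> (\<lambda>x. 0 + x) ` cartesian_lattice 1 = (\<Union>k\<in>I. int_box N \<inter> T k)"
    using union mem_coset_iff[of _ 0 1] by auto
  also have "sum (coord_char (a m)) \<dots> = (\<Sum>k\<in>I. sum (coord_char (a m)) (int_box N \<inter> T k))"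
    using fin disj by (intro sum.UNION_disjoint) (auto simp: finite_int_box disjoint_family_on_def)
  also have "\<dots> = sum (coord_char (a m)) (int_box N \<inter> T m)"
    using fin m(1) zero by (subst sum.remove[of _ m]) auto
  finally show False
    using T[OF m(1)] sum_coord_char_coset_neq_0[OF pos[OF m(1)] N dvd[OF m(1)]] by simp
qed

corollary coset_partition_translates:
  fixes T :: "'i \<Rightarrow> (int ^ 'd) set"
  assumes "finite I" "card I \<ge> 2" "\<And>k. k \<in> I \<Longrightarrow> cartesian_coset (T k)"
    and "disjoint_family_on T I" "(\<Union>k\<in>I. T k) = UNIV"
  shows "\<exists>k\<in>I. \<exists>l\<in>I. k \<noteq> l \<and> is_translate (T k) (T l)"
proof -
  obtain v a where va: "\<And>k i. k \<in> I \<Longrightarrow> a k $ i > 0"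
    "\<And>k. k \<in> I \<Longrightarrow> T k = (\<lambda>x. v k + x) ` cartesian_lattice (a k)"
    using assms(3) unfolding cartesian_coset_def by metis
  obtain k l where kl: "k \<in> I" "l \<in> I" "k \<noteq> l" "a k = a l"
    using disjoint_cosets_equal_differences[OF assms(1,2) va assms(4,5)] by blast
  \<comment> \<open>Equal differences give the same lattice, so the tiles differ only by their base
    points.\<close>
  then have "T l = (\<lambda>x. (v l - v k) + x) ` T k"
    by (simp add: va(2) image_image)
  then show ?thesis
    using kl unfolding is_translate_def by blast
qed

theorem mainTheorem1:
  shows "\<not> (\<exists>\<T> :: (int ^ 'd) set set.
            tiling \<T> UNIV \<and> (\<forall>T\<in>\<T>. cartesian_coset T) \<and>
            (\<forall>T\<in>\<T>. \<forall>T'\<in>\<T>. T \<noteq> T' \<longrightarrow> \<not> is_translate T T'))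
       \<and> (\<forall>(n::nat) (T :: nat \<Rightarrow> (int ^ 'd) set).
            n \<ge> 2 \<and> (\<forall>i\<in>{1..n}. cartesian_coset (T i)) \<and>
            disjoint_family_on T {1..n} \<and> (\<Union>i\<in>{1..n}. T i) = UNIV \<longrightarrow>
            (\<exists>i\<in>{1..n}. \<exists>j\<in>{1..n}. i \<noteq> j \<and> is_translate (T i) (T j)))"
proof (intro conjI allI impI notI; elim exE conjE)
  fix \<T> :: "(int ^ 'd) set set"
  assume \<T>: "tiling \<T> UNIV" "\<forall>T\<in>\<T>. cartesian_coset T"
    and no_translates: "\<forall>T\<in>\<T>. \<forall>T'\<in>\<T>. T \<noteq> T' \<longrightarrow> \<not> is_translate T T'"
  \<comment> \<open>The set of tiles becomes a family indexed by itself, so distinct indices are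
    distinct tiles.\<close>
  have "disjoint_family_on (\<lambda>T. T) \<T>"
    using \<T>(1) by (simp add: tiling_def disjoint_family_on_def disjoint_def)
  then have "\<exists>T\<in>\<T>. \<exists>T'\<in>\<T>. T \<noteq> T' \<and> is_translate T T'"
    using \<T> by (intro coset_partition_translates) (simp_all add: tiling_def)
  with no_translates show False
    by metis
next
  fix n :: nat and T :: "nat \<Rightarrow> (int ^ 'd) set"
  assume "n \<ge> 2" "\<forall>i\<in>{1..n}. cartesian_coset (T i)"
    "disjoint_family_on T {1..n}" "(\<Union>i\<in>{1..n}. T i) = UNIV"
  then show "\<exists>i\<in>{1..n}. \<exists>j\<in>{1..n}. i \<noteq> j \<and> is_translate (T i) (T j)"
    by (intro coset_partition_translates) simp_all
qed

end
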